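(* Let $g\in C^\infty$, and let $R$ be the radius of convergence of the Maclaurin series of $g$. Let $X=(x_1,\dots,x_n)$ and $A=(a_1,\dots,a_n)$ be $n$-tuples of real numbers such that $x_i\neq x_j$ and $a_i\neq a_j$ for $i\neq j$. Let $G=(g_1,\dots,g_n)$, where $g_k(x):=g(a_kx)$, defined on $x\in(-R/a_k,R/a_k)$, and let $$M_G(X):=\big(g(a_jx_i)\big)_{1\le i,j\le n}$$ be the collocation matrix of the system $G$ on the $n$-tuple $X$. Then, for $x_k\in(-R/a_{\max},R/a_{\max})$ ($k=1,\dots,n$), where $a_{\max}=\max\{|a_1|,\dots,|a_n|\}$, we have $$\sum_{\lambda}\frac{G_\lambda}{C_\lambda}\,s_\lambda(a_1,\dots,a_n)\,s_\lambda(x_1,\dots,x_n)=\frac{\det M_G(X)}{|V_{x_1,\dots,x_n}|\,|V_{a_1,\dots,a_n}|},$$ where the sum runs over partitions $\lambda=(\lambda_1,\dots,\lambda_n)$, $s_\lambda(x_1,\dots,x_n)$ is the Schur polynomial corresponding to $\lambda$, and $$G_\lambda:=\prod_{l=1}^n g^{(\lambda_l+n-l)}(0),\qquad C_\lambda:=\prod_{l=1}^n(\lambda_l+n-l)!.$$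
   Context: The Maclaurin series of $g$ is $\sum_{k\ge 0}\frac{g^{(k)}(0)}{k!}x^k$. For an $n$-tuple $(x_1,\dots,x_n)$, $|V_{x_1,\dots,x_n}|$ denotes the Vandermonde determinant $\det\big(x_i^{n-j}\big)_{1\le i,j\le n}=\prod_{i<j}(x_i-x_j)$ (a determinant, not an absolute value), and similarly for $|V_{a_1,\dots,a_n}|$. A partition $\lambda=(\lambda_1,\dots,\lambda_n)$ is a sequence of integers $\lambda_1\ge\dots\ge\lambda_n\ge 0$, padded with zeros to length $n$ if necessary; the Schur polynomial is given by Jacobi's bialternant formula $$s_\lambda(x_1,\dots,x_n)=\frac{\det\big(x_i^{\lambda_j+n-j}\big)_{1\le i,j\le n}}{|V_{x_1,\dots,x_n}|}.$$ Schur polynomials in $n$ variables vanish for partitions with more than $n$ nonzero parts, so only partitions with at most $n$ parts contribute to the sum.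
   Formalization: The formal statement assumes in addition that g equals the sum of its Maclaurin series on (-R,R); for merely smooth g the claim fails (n=1, g(t)=exp(-1/t^2), g(0)=0). Smoothness of g is required only on (-R,R). *)

theory Defs
  imports
    "HOL-Analysis.Derivative"
    "HOL-Analysis.Infinite_Sum"
    "HOL-Analysis.Summation_Tests"
    "Jordan_Normal_Form.Determinant"
begin

text \<open>
  An \<open>n\<close>-tuple is a function on \<open>nat\<close> of which only the values at
  \<open>0, \<dots>, n - 1\<close> matter. Indices are shifted down by one with respect to the
  usual notation, so that the exponent \<open>n - j\<close> with \<open>1 \<le> j \<le> n\<close> becomes
  \<open>n - 1 - j\<close> with \<open>j < n\<close>. The names \<open>det\<close> and \<open>mat\<close> are qualified because
  HOL-Analysis has constants of the same name.
\<close>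

definition vandermonde :: "nat \<Rightarrow> (nat \<Rightarrow> 'a :: field) \<Rightarrow> 'a" where
  "vandermonde n x = Determinant.det (Matrix.mat n n (\<lambda>(i, j). x i ^ (n - 1 - j)))"

text \<open>
  Partitions are padded with zeros beyond position \<open>n\<close>, so that each one is
  represented by exactly one function.
\<close>

definition partitions :: "nat \<Rightarrow> (nat \<Rightarrow> nat) set" where
  "partitions n = {p. antimono p \<and> (\<forall>i\<ge>n. p i = 0)}"

definition schur :: "nat \<Rightarrow> (nat \<Rightarrow> nat) \<Rightarrow> (nat \<Rightarrow> 'a :: field) \<Rightarrow> 'a" where
  "schur n p x =
     Determinant.det (Matrix.mat n n (\<lambda>(i, j). x i ^ (p j + (n - 1 - j)))) / vandermonde n x"

text \<open>
  For open \<open>S\<close>: every \<open>deriv ^^ k\<close> is then determined on \<open>S\<close> by \<open>g\<close> on \<open>S\<close>, and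
  continuity of the derivatives follows from their differentiability.
\<close>

definition smooth_on :: "real set \<Rightarrow> (real \<Rightarrow> real) \<Rightarrow> bool" where
  "smooth_on S g \<longleftrightarrow> (\<forall>k. \<forall>t\<in>S. (deriv ^^ k) g differentiable (at t))"

definition maclaurin_coeff :: "(real \<Rightarrow> real) \<Rightarrow> nat \<Rightarrow> real" where
  "maclaurin_coeff g k = (deriv ^^ k) g 0 / fact k"

definition maclaurin_radius :: "(real \<Rightarrow> real) \<Rightarrow> ereal" where
  "maclaurin_radius g = conv_radius (maclaurin_coeff g)"

definition collocation_matrix ::
    "nat \<Rightarrow> (nat \<Rightarrow> real \<Rightarrow> real) \<Rightarrow> (nat \<Rightarrow> real) \<Rightarrow> real Matrix.mat" where
  "collocation_matrix n G x = Matrix.mat n n (\<lambda>(i, j). G j (x i))"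

definition G_coeff :: "nat \<Rightarrow> (real \<Rightarrow> real) \<Rightarrow> (nat \<Rightarrow> nat) \<Rightarrow> real" where
  "G_coeff n g p = (\<Prod>l<n. (deriv ^^ (p l + (n - 1 - l))) g 0)"

definition C_coeff :: "nat \<Rightarrow> (nat \<Rightarrow> nat) \<Rightarrow> real" where
  "C_coeff n p = (\<Prod>l<n. fact (p l + (n - 1 - l)))"

end

theory Submission
  imports Defs "HOL-Analysis.Infinite_Set_Sum"
begin

text \<open>
  Since \<open>g (a\<^sub>j x\<^sub>i) = \<Sum>\<^sub>k c\<^sub>k x\<^sub>i\<^sup>k a\<^sub>j\<^sup>k\<close> with \<open>c\<^sub>k\<close> the Maclaurin
  coefficients, the collocation matrix is the product of the \<open>n \<times> \<infinity>\<close> matrix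
  \<open>(c\<^sub>k x\<^sub>i\<^sup>k)\<close> and the \<open>\<infinity> \<times> n\<close> matrix \<open>(a\<^sub>j\<^sup>k)\<close>. By an absolutely convergent
  Cauchy-Binet formula its determinant is the sum, over all strictly decreasing exponent
  sequences \<open>m\<close>, of \<open>\<Prod>\<^sub>l c(m\<^sub>l)\<close> times the two corresponding generalised
  Vandermonde minors. The substitution \<open>m\<^sub>l = \<lambda>\<^sub>l + (n - 1 - l)\<close>
  turns these sequences into partitions and the minors into numerators of Schur polynomials.
\<close>

section \<open>Finite sums and products of absolutely convergent series\<close>

lemma has_sum_sum:
  fixes f :: "'i \<Rightarrow> 'b \<Rightarrow> 'a :: topological_comm_monoid_add"
  assumes "\<And>i. i \<in> I \<Longrightarrow> (f i has_sum s i) A"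
  shows "((\<lambda>x. \<Sum>i\<in>I. f i x) has_sum (\<Sum>i\<in>I. s i)) A"
  using assms by (induction I rule: infinite_finite_induct) (auto intro: has_sum_add)

text \<open>This is the distributive law that expands a product of finitely many series into one sum
  over all choices of indices. Absolute convergence of the factors makes the expanded family
  absolutely summable, so no order of summation has to be fixed.\<close>

lemma has_sum_prod_PiE:
  fixes f :: "'i \<Rightarrow> 'b :: countable \<Rightarrow> 'a :: {real_normed_field, banach, second_countable_topology}"
  assumes "finite I" "\<And>i. i \<in> I \<Longrightarrow> (\<lambda>k. norm (f i k)) summable_on B i"
  shows "((\<lambda>h. \<Prod>i\<in>I. f i (h i)) has_sum (\<Prod>i\<in>I. infsum (f i) (B i))) (PiE I B)"
proof -
  have "(\<lambda>h. norm (\<Prod>i\<in>I. f i (h i))) summable_on PiE I B"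
    using abs_summable_on_prod_PiE[OF assms(1), of B f] assms(2)
    by (simp add: abs_summable_equivalent)
  then show ?thesis
    unfolding has_sum_iff using infsum_prod_PiE_abs[of I f B] assms
    by (intro conjI) (rule abs_summable_summable, auto)
qed

section \<open>Sorting injective tuples\<close>

text \<open>Two decreasing sequences related by \<open>p\<close> force \<open>p\<close> to be
  strictly increasing on \<open>{0..<n}\<close>. Hence \<open>i \<le> p i\<close> there, and a
  permutation that never moves an index down is the identity.\<close>

lemma strict_antimono_on_comp_permutes_eq_id:
  fixes m m' :: "nat \<Rightarrow> nat"
  assumes m: "strict_antimono_on {0..<n} m" and m': "strict_antimono_on {0..<n} m'"
    and p: "p permutes {0..<n}" and eq: "\<And>i. i < n \<Longrightarrow> m i = m' (p i)"
  shows "p = id"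
proof -
  have mono: "p i < p j" if "i < j" "j < n" for i j
  proof (rule ccontr)
    assume "\<not> p i < p j"
    moreover have "p i \<noteq> p j"
      using permutes_inj[OF p] that by (auto dest: injD)
    moreover have "p i < n" "p j < n"
      using permutes_in_image[OF p] that by auto
    ultimately have "m' (p i) < m' (p j)"
      using m' by (auto simp: monotone_on_def)
    moreover have "m j < m i"
      using m that by (auto simp: monotone_on_def)
    ultimately show False
      using eq[of i] eq[of j] that by auto
  qed
  have "i \<le> p i" if "i < n" for i
    using that
  proof (induction i)
    case (Suc i)
    then show ?case
      using mono[of i "Suc i"] by force
  qed simp
  then show ?thesis
    by (intro permutes_natset_ge[OF p]) auto
qed

text \<open>Extensionality leaves one function for each finite sequence, so that the reindexing maps
  below can be bijections.\<close>

definition strict_decreasing :: "nat \<Rightarrow> (nat \<Rightarrow> nat) set" where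
  "strict_decreasing n = {m \<in> extensional {0..<n}. strict_antimono_on {0..<n} m}"

lemma inj_on_strict_antimono:
  fixes m :: "nat \<Rightarrow> nat"
  assumes "strict_antimono_on {0..<n} m"
  shows "inj_on m {0..<n}"
  using assms by (intro linorder_inj_onI) (force simp: monotone_on_def dest: bspec)+

text \<open>This splits a sum over injective tuples into an outer sum over sorted tuples and an
  inner sum over permutations. Surjectivity comes from enumerating the image of the tuple,
  injectivity from the rigidity of decreasing sequences.\<close>

lemma bij_betw_sort:
  "bij_betw (\<lambda>(m, p). restrict (m \<circ> p) {0..<n})
     (strict_decreasing n \<times> {p. p permutes {0..<n}})
     {h \<in> extensional {0..<n}. inj_on h {0..<n}}"
  (is "bij_betw ?F (?D \<times> ?P) ?H")
proof (rule bij_betw_imageI)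
  show "inj_on ?F (?D \<times> ?P)"
  proof (clarsimp simp: inj_on_def)
    fix m p m' p'
    assume m: "m \<in> ?D" and m': "m' \<in> ?D"
      and p: "p permutes {0..<n}" and p': "p' permutes {0..<n}"
      and eq: "restrict (m \<circ> p) {0..<n} = restrict (m' \<circ> p') {0..<n}"
    have eq': "m (p i) = m' (p' i)" if "i < n" for i
      using fun_cong[OF eq, of i] that by simp
    \<comment> \<open>On \<open>{0..<n}\<close> this permutation satisfies
      \<open>m = m' \<circ> ?q\<close>, so the preceding lemma makes it the identity.\<close>
    let ?q = "p' \<circ> Hilbert_Choice.inv p"
    have q: "?q permutes {0..<n}"
      by (intro permutes_compose permutes_inv p p')
    have "m i = m' (?q i)" if "i < n" for i
    proof -
      have "Hilbert_Choice.inv p i < n"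
        using permutes_in_image[OF permutes_inv[OF p], of i] that by simp
      then show ?thesis
        using eq'[of "Hilbert_Choice.inv p i"] permutes_inverses(1)[OF p] by simp
    qed
    note mq = this
    then have "?q = id"
      using m m' q by (intro strict_antimono_on_comp_permutes_eq_id[of n m m'])
        (auto simp: strict_decreasing_def)
    moreover from this have "p' = p"
      using permutes_inverses(2)[OF p] by (auto simp: fun_eq_iff) metis
    moreover have "m = m'"
    proof (rule extensionalityI[of _ "{0..<n}"])
      show "m i = m' i" if "i \<in> {0..<n}" for i
        using mq[of i] that \<open>?q = id\<close> by (simp add: fun_eq_iff)
    qed (use m m' in \<open>auto simp: strict_decreasing_def\<close>)
    ultimately show "m = m' \<and> p = p'"
      by simp
  qed
  show "?F ` (?D \<times> ?P) = ?H"
  proof (intro equalityI subsetI)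
    fix h assume "h \<in> ?F ` (?D \<times> ?P)"
    then obtain m p where m: "m \<in> ?D" and p: "p permutes {0..<n}"
      and h: "h = restrict (m \<circ> p) {0..<n}"
      by auto
    have "inj_on (m \<circ> p) {0..<n}"
      using m p by (intro comp_inj_on)
        (auto simp: permutes_image strict_decreasing_def intro: inj_on_strict_antimono permutes_inj_on)
    then show "h \<in> ?H"
      by (simp add: h inj_on_def)
  next
    fix h assume h: "h \<in> ?H"
    define S where "S = h ` {0..<n}"
    have card_S: "card S = n"
      using h by (simp add: S_def card_image)
    obtain e where e: "bij_betw e {..<card S} S" "strict_mono_on {..<card S} e"
      by (rule ex_bij_betw_strict_mono_card[of S]) (auto simp: S_def)
    \<comment> \<open>Reading the increasing enumeration \<open>e\<close> of \<open>S\<close>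
      backwards gives the decreasing one.\<close>
    define m where "m = restrict (\<lambda>i. e (n - 1 - i)) {0..<n}"
    have m: "m \<in> ?D"
      using e(2) by (auto simp: m_def strict_decreasing_def monotone_on_def card_S)
    have inj_m: "inj_on m {0..<n}"
      using m by (intro inj_on_strict_antimono) (auto simp: strict_decreasing_def)
    have "m ` {0..<n} \<subseteq> S"
      using e(1) by (auto simp: m_def card_S bij_betw_def)
    then have "m ` {0..<n} = S"
      using inj_m card_S by (intro card_subset_eq) (auto simp: S_def card_image)
    then have bij_m: "bij_betw m {0..<n} S"
      using inj_m by (simp add: bij_betw_def)
    have "bij_betw h {0..<n} S"
      using h by (simp add: S_def bij_betw_def)
    then have bij: "bij_betw (inv_into {0..<n} m \<circ> h) {0..<n} {0..<n}"
      using bij_betw_inv_into[OF bij_m] by (rule bij_betw_trans)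
    define p where "p i = (if i \<in> {0..<n} then inv_into {0..<n} m (h i) else i)" for i
    have p: "p permutes {0..<n}"
    proof (rule bij_imp_permutes)
      show "bij_betw p {0..<n} {0..<n}"
        using bij by (rule bij_betw_cong[THEN iffD1, rotated]) (simp add: p_def)
    qed (simp add: p_def)
    have "h = ?F (m, p)"
    proof (rule extensionalityI[of _ "{0..<n}"])
      show "h i = ?F (m, p) i" if "i \<in> {0..<n}" for i
        using that bij_betw_inv_into_right[OF bij_m, of "h i"] by (simp add: p_def S_def)
    qed (use h in auto)
    then show "h \<in> ?F ` (?D \<times> ?P)"
      using m p by blast
  qed
qed

section \<open>Cauchy-Binet formula for infinitely many columns\<close>

text \<open>Each Leibniz term is a product of \<open>n\<close> series and expands into a sum over
  tuples \<open>h\<close>. The factors \<open>u i (h i)\<close> do not depend on the permutation, so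
  for fixed \<open>h\<close> the remaining factors reassemble into a determinant in
  \<open>v\<close>.\<close>

lemma has_sum_det_prod:
  fixes u v :: "nat \<Rightarrow> nat \<Rightarrow> 'a :: {real_normed_field, banach, second_countable_topology}"
  assumes summable: "\<And>i j. i < n \<Longrightarrow> j < n \<Longrightarrow> summable (\<lambda>k. norm (u i k * v j k))"
  shows "((\<lambda>h. (\<Prod>i=0..<n. u i (h i)) * Determinant.det (Matrix.mat n n (\<lambda>(i, j). v j (h i))))
           has_sum Determinant.det (Matrix.mat n n (\<lambda>(i, j). \<Sum>k. u i k * v j k)))
         (extensional {0..<n})"
proof -
  have "((\<lambda>h. \<Sum>p | p permutes {0..<n}. signof p * (\<Prod>i=0..<n. u i (h i) * v (p i) (h i)))
          has_sum (\<Sum>p | p permutes {0..<n}. signof p * (\<Prod>i=0..<n. \<Sum>k. u i k * v (p i) k)))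
        (PiE {0..<n} (\<lambda>_. UNIV))"
  proof (intro has_sum_sum has_sum_cmult_right)
    fix p assume "p \<in> {p. p permutes {0..<n}}"
    then have p: "p i < n" if "i < n" for i
      using permutes_in_image[of p "{0..<n}" i] that by simp
    have "infsum (\<lambda>k. u i k * v (p i) k) UNIV = (\<Sum>k. u i k * v (p i) k)" if "i < n" for i
    proof -
      have "summable (\<lambda>k. norm (u i k * v (p i) k))"
        using that p by (intro summable)
      then show ?thesis
        by (intro infsumI norm_summable_imp_has_sum[OF _ summable_sums[OF summable_norm_cancel]])
    qed
    moreover have "((\<lambda>h. \<Prod>i=0..<n. u i (h i) * v (p i) (h i)) has_sum
        (\<Prod>i=0..<n. infsum (\<lambda>k. u i k * v (p i) k) UNIV)) (PiE {0..<n} (\<lambda>_. UNIV))"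
      by (rule has_sum_prod_PiE) (use summable p in \<open>auto simp: summable_on_UNIV_nonneg_real_iff\<close>)
    ultimately show "((\<lambda>h. \<Prod>i=0..<n. u i (h i) * v (p i) (h i)) has_sum
        (\<Prod>i=0..<n. \<Sum>k. u i k * v (p i) k)) (PiE {0..<n} (\<lambda>_. UNIV))"
      by simp
  qed
  also have "(\<Sum>p | p permutes {0..<n}. signof p * (\<Prod>i=0..<n. \<Sum>k. u i k * v (p i) k))
      = Determinant.det (Matrix.mat n n (\<lambda>(i, j). \<Sum>k. u i k * v j k))"
    by (subst det_def'[of _ n]) (auto intro!: sum.cong prod.cong dest: permutes_in_image)
  also have "(\<lambda>h. \<Sum>p | p permutes {0..<n}. signof p * (\<Prod>i=0..<n. u i (h i) * v (p i) (h i)))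
      = (\<lambda>h. (\<Prod>i=0..<n. u i (h i)) * Determinant.det (Matrix.mat n n (\<lambda>(i, j). v j (h i))))"
    by (subst det_def'[of _ n])
      (auto simp: sum_distrib_left prod.distrib intro!: sum.cong prod.cong dest: permutes_in_image)
  also have "PiE {0..<n} (\<lambda>_. UNIV) = extensional {0..<n}"
    by (simp add: PiE_def)
  finally show ?thesis .
qed

text \<open>In the expansion over all tuples, those with a repeated index contribute two equal rows
  and vanish. The others are sorted; the sign from reordering the rows of the \<open>v\<close>
  determinant combines with the \<open>u\<close> factors to form the second determinant.\<close>

lemma has_sum_Cauchy_Binet:
  fixes u v :: "nat \<Rightarrow> nat \<Rightarrow> 'a :: {real_normed_field, banach, second_countable_topology}"
  assumes summable: "\<And>i j. i < n \<Longrightarrow> j < n \<Longrightarrow> summable (\<lambda>k. norm (u i k * v j k))"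
  shows "((\<lambda>m. Determinant.det (Matrix.mat n n (\<lambda>(i, j). u i (m j)))
             * Determinant.det (Matrix.mat n n (\<lambda>(i, j). v i (m j))))
           has_sum Determinant.det (Matrix.mat n n (\<lambda>(i, j). \<Sum>k. u i k * v j k)))
         (strict_decreasing n)"
    (is "(_ has_sum ?S) _")
proof -
  define V where "V h = Determinant.det (Matrix.mat n n (\<lambda>(i, j). v j (h i)))" for h :: "nat \<Rightarrow> nat"
  have V_noninj: "V h = 0" if noninj: "\<not> inj_on h {0..<n}" for h
  proof -
    obtain i j where ij: "i < n" "j < n" "i \<noteq> j" "h i = h j"
      using noninj by (auto simp: inj_on_def)
    then show ?thesis
      unfolding V_def by (intro det_identical_rows[of _ n i j]) auto
  qed
  have V_perm: "V (restrict (m \<circ> p) {0..<n}) = signof p * V m"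
    if p: "p permutes {0..<n}" for m p
  proof -
    have "V (restrict (m \<circ> p) {0..<n}) = Determinant.det (Matrix.mat n n
        (\<lambda>(i, j). Matrix.mat n n (\<lambda>(i, j). v j (m i)) $$ (p i, j)))"
      unfolding V_def using permutes_in_image[OF p]
      by (intro arg_cong[where f = Determinant.det] eq_matI) auto
    also have "\<dots> = signof p * V m"
      unfolding V_def by (rule det_permute_rows) (use p in auto)
    finally show ?thesis .
  qed
  have V_transpose: "V m = Determinant.det (Matrix.mat n n (\<lambda>(i, j). v i (m j)))" for m
    unfolding V_def
    by (subst det_transpose[symmetric, of _ n])
      (auto intro!: arg_cong[where f = Determinant.det] eq_matI)
  have "((\<lambda>h. (\<Prod>i=0..<n. u i (h i)) * V h) has_sum ?S) (extensional {0..<n})"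
    unfolding V_def using summable by (rule has_sum_det_prod)
  then have "((\<lambda>h. (\<Prod>i=0..<n. u i (h i)) * V h) has_sum ?S)
      {h \<in> extensional {0..<n}. inj_on h {0..<n}}"
    by (rule has_sum_cong_neutral[THEN iffD1, rotated -1]) (auto simp: V_noninj)
  then have "((\<lambda>q. (\<Prod>i=0..<n. u i ((\<lambda>(m, p). restrict (m \<circ> p) {0..<n}) q i))
        * V ((\<lambda>(m, p). restrict (m \<circ> p) {0..<n}) q)) has_sum ?S)
      (strict_decreasing n \<times> {p. p permutes {0..<n}})"
    by (subst has_sum_reindex_bij_betw[OF bij_betw_sort])
  then show ?thesis
  proof (rule has_sum_SigmaD)
    \<comment> \<open>The joint sum over pairs is already known, so only the finite sum over
      permutations with \<open>m\<close> fixed remains to be evaluated; it is the Leibniz formula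
      for \<open>u\<close>.\<close>
    fix m
    have "(\<Prod>i=0..<n. u i (restrict (m \<circ> p) {0..<n} i)) * V (restrict (m \<circ> p) {0..<n})
        = signof p * (\<Prod>i=0..<n. u i (m (p i))) * V m" if "p permutes {0..<n}" for p
      unfolding V_perm[OF that] by simp
    then have "(\<Sum>p | p permutes {0..<n}.
          (\<Prod>i=0..<n. u i (restrict (m \<circ> p) {0..<n} i)) * V (restrict (m \<circ> p) {0..<n}))
        = (\<Sum>p | p permutes {0..<n}. signof p * (\<Prod>i=0..<n. u i (m (p i)))) * V m"
      unfolding sum_distrib_right by (intro sum.cong) auto
    also have "(\<Sum>p | p permutes {0..<n}. signof p * (\<Prod>i=0..<n. u i (m (p i))))
        = Determinant.det (Matrix.mat n n (\<lambda>(i, j). u i (m j)))"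
      by (subst det_def'[of _ n]) (auto intro!: sum.cong prod.cong dest: permutes_in_image)
    finally show "((\<lambda>p. (\<Prod>i=0..<n. u i ((\<lambda>(m, p). restrict (m \<circ> p) {0..<n}) (m, p) i))
          * V ((\<lambda>(m, p). restrict (m \<circ> p) {0..<n}) (m, p)))
        has_sum Determinant.det (Matrix.mat n n (\<lambda>(i, j). u i (m j)))
             * Determinant.det (Matrix.mat n n (\<lambda>(i, j). v i (m j)))) {p. p permutes {0..<n}}"
      by (simp only: has_sum_finite_iff finite_permutations finite_atLeastLessThan prod.case V_transpose)
  qed
qed

section \<open>From exponent sequences to partitions\<close>

text \<open>Every Leibniz term takes exactly one entry from each column, so all of them share the
  factor \<open>\<Prod>j<n. c j\<close>.\<close>

lemma det_mult_columns:
  fixes c :: "nat \<Rightarrow> 'a :: comm_ring_1"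
  shows "Determinant.det (Matrix.mat n n (\<lambda>(i, j). c j * f i j))
       = (\<Prod>j<n. c j) * Determinant.det (Matrix.mat n n (\<lambda>(i, j). f i j))"
proof -
  have "(\<Prod>i=0..<n. c (p i) * f i (p i)) = (\<Prod>j<n. c j) * (\<Prod>i=0..<n. f i (p i))"
    if "p permutes {0..<n}" for p
    using prod.permute[OF that, of c] by (simp add: prod.distrib o_def lessThan_atLeast0)
  moreover have "Determinant.det (Matrix.mat n n (\<lambda>(i, j). h i j))
      = (\<Sum>p | p permutes {0..<n}. signof p * (\<Prod>i=0..<n. h i (p i)))"
    for h :: "nat \<Rightarrow> nat \<Rightarrow> 'a"
    by (subst det_def'[of _ n]) (auto intro!: sum.cong prod.cong dest: permutes_in_image)
  ultimately show ?thesis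
    by (simp add: sum_distrib_left mult.left_commute)
qed

text \<open>Adding the staircase \<open>n - 1, ..., 1, 0\<close> turns weak decrease into strict
  decrease, and subtracting it undoes this.\<close>

lemma bij_betw_partitions:
  "bij_betw (\<lambda>p. restrict (\<lambda>l. p l + (n - 1 - l)) {0..<n}) (partitions n) (strict_decreasing n)"
proof (rule bij_betw_byWitness[where f' = "\<lambda>m l. if l < n then m l - (n - 1 - l) else 0"])
  show "\<forall>p\<in>partitions n. (\<lambda>l. if l < n then restrict (\<lambda>l. p l + (n - 1 - l)) {0..<n} l - (n - 1 - l) else 0) = p"
    by (auto simp: partitions_def fun_eq_iff)
  \<comment> \<open>A strictly decreasing sequence of integers drops by at least one per step. This
    shows both that the natural-number subtraction never truncates and that its result still
    decreases weakly.\<close>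
  have gap: "m j + (j - i) \<le> m i" if m: "m \<in> strict_decreasing n" and "i \<le> j" "j < n" for m i j
    using \<open>i \<le> j\<close> \<open>j < n\<close>
  proof (induction j rule: dec_induct)
    case (step j)
    then have "m (Suc j) < m j"
      using m by (auto simp: strict_decreasing_def monotone_on_def)
    then show ?case
      using step by auto
  qed simp
  have lower: "n - 1 - l \<le> m l" if "m \<in> strict_decreasing n" "l < n" for m l
    using gap[OF that(1), of l "n - 1"] that(2) by linarith
  show "\<forall>m\<in>strict_decreasing n. restrict (\<lambda>l. (if l < n then m l - (n - 1 - l) else 0) + (n - 1 - l)) {0..<n} = m"
  proof
    fix m assume m: "m \<in> strict_decreasing n"
    show "restrict (\<lambda>l. (if l < n then m l - (n - 1 - l) else 0) + (n - 1 - l)) {0..<n} = m"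
    proof (rule extensionalityI[of _ "{0..<n}"])
      fix l assume "l \<in> {0..<n}"
      then show "restrict (\<lambda>l. (if l < n then m l - (n - 1 - l) else 0) + (n - 1 - l)) {0..<n} l = m l"
        using le_add_diff_inverse2[OF lower[OF m, of l]] by simp
    qed (use m in \<open>auto simp: strict_decreasing_def\<close>)
  qed
  show "(\<lambda>p. restrict (\<lambda>l. p l + (n - 1 - l)) {0..<n}) ` partitions n \<subseteq> strict_decreasing n"
  proof clarify
    fix p assume "p \<in> partitions n"
    then have "p j + (n - 1 - j) < p i + (n - 1 - i)" if "i < j" "j < n" for i j
      using that by (intro add_le_less_mono) (auto simp: partitions_def antimono_def)
    then show "restrict (\<lambda>l. p l + (n - 1 - l)) {0..<n} \<in> strict_decreasing n"
      by (simp add: strict_decreasing_def monotone_on_def)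
  qed
  show "(\<lambda>m l. if l < n then m l - (n - 1 - l) else 0) ` strict_decreasing n \<subseteq> partitions n"
  proof clarify
    fix m assume m: "m \<in> strict_decreasing n"
    have "m j - (n - 1 - j) \<le> m i - (n - 1 - i)" if "i \<le> j" "j < n" for i j
      using gap[OF m that] that by linarith
    then show "(\<lambda>l. if l < n then m l - (n - 1 - l) else 0) \<in> partitions n"
      by (auto simp: partitions_def antimono_def)
  qed
qed

section \<open>Products inside the interval of convergence\<close>

lemma abs_mult_less_of_range:
  fixes R :: ereal and b s t :: real
  assumes range: "ereal t \<in> {- (R / ereal b)<..<R / ereal b}" and s: "\<bar>s\<bar> \<le> b"
  shows "ereal \<bar>s * t\<bar> < R"
proof -
  have t: "ereal \<bar>t\<bar> < R / ereal b"
    using range by (cases "t \<ge> 0") (auto simp: ereal_uminus_less_reorder abs_if)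
  show ?thesis
  proof (cases "b = 0")
    \<comment> \<open>Here \<open>R / 0\<close> means \<open>R\<close> times infinity, so a nonempty
      range still forces \<open>0 < R\<close>, while \<open>s\<close> is zero.\<close>
    case True
    then have "0 < R"
      using t by (cases R) (auto simp: divide_ereal_def zero_ereal_def split: if_splits)
    then show ?thesis
      using s True by (simp add: zero_ereal_def)
  next
    case False
    then have b: "b > 0"
      using s by auto
    show ?thesis
    proof (cases R)
      case (real r)
      have "\<bar>t\<bar> < r / b"
        using t b real by simp
      then have "b * \<bar>t\<bar> < r"
        using b by (simp add: field_simps)
      moreover have "\<bar>s * t\<bar> \<le> b * \<bar>t\<bar>"
        using s by (simp add: abs_mult mult_right_mono)
      ultimately show ?thesis
        using real by simp
    next
      case MInf
      then show ?thesis
        using t b by (simp add: divide_ereal_def)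
    qed simp
  qed
qed

section \<open>Schur expansion of the collocation determinant\<close>

theorem theorem1:
  fixes g :: "real \<Rightarrow> real" and n :: nat and x a :: "nat \<Rightarrow> real"
    and R :: ereal and a_max :: real
  assumes "n \<ge> 1"
    and R: "R = maclaurin_radius g"
    and smooth: "smooth_on {t. ereal \<bar>t\<bar> < R} g"
    and maclaurin: "\<And>t. ereal \<bar>t\<bar> < R \<Longrightarrow> (\<lambda>k. maclaurin_coeff g k * t ^ k) sums g t"
    and x_distinct: "inj_on x {..<n}"
    and a_distinct: "inj_on a {..<n}"
    and a_max: "a_max = Max ((\<lambda>k. \<bar>a k\<bar>) ` {..<n})"
    and x_range: "\<And>k. k < n \<Longrightarrow> ereal (x k) \<in> {- (R / ereal a_max)<..<R / ereal a_max}"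
  shows "((\<lambda>p. G_coeff n g p / C_coeff n p * schur n p a * schur n p x) has_sum
           (Determinant.det (collocation_matrix n (\<lambda>k t. g (a k * t)) x)
             / (vandermonde n x * vandermonde n a)))
         (partitions n)"
proof -
  define c where "c = maclaurin_coeff g"
  define D where "D y m = Determinant.det (Matrix.mat n n (\<lambda>(i, j). y i ^ m j))"
    for y :: "nat \<Rightarrow> real" and m :: "nat \<Rightarrow> nat"
  let ?m = "\<lambda>p. restrict (\<lambda>l. p l + (n - 1 - l)) {0..<n}"
  let ?M = "Determinant.det (collocation_matrix n (\<lambda>k t. g (a k * t)) x)"
  have less: "ereal \<bar>a j * x i\<bar> < R" if "i < n" "j < n" for i j
    using that by (intro abs_mult_less_of_range[OF x_range]) (auto simp: a_max)
  have summable: "summable (\<lambda>k. norm (c k * x i ^ k * a j ^ k))" if "i < n" "j < n" for i j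
  proof -
    have "ereal (norm (a j * x i)) < conv_radius c"
      using less[OF that] by (simp add: R maclaurin_radius_def c_def)
    then have "summable (\<lambda>k. norm (c k * (a j * x i) ^ k))"
      by (rule abs_summable_in_conv_radius)
    then show ?thesis
      by (simp add: power_mult_distrib mult_ac)
  qed
  have "(\<Sum>k. c k * x i ^ k * a j ^ k) = g (a j * x i)" if "i < n" "j < n" for i j
    using sums_unique[OF maclaurin[OF less[OF that]]]
    by (simp add: c_def power_mult_distrib mult_ac)
  then have "Matrix.mat n n (\<lambda>(i, j). \<Sum>k. c k * x i ^ k * a j ^ k)
      = collocation_matrix n (\<lambda>k t. g (a k * t)) x"
    unfolding collocation_matrix_def by (intro eq_matI) auto
  \<comment> \<open>The Maclaurin coefficients are all put into the \<open>x\<close> factor; there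
    they scale whole columns and can be pulled out of the determinant.\<close>
  then have "((\<lambda>m. Determinant.det (Matrix.mat n n (\<lambda>(i, j). c (m j) * x i ^ m j)) * D a m)
      has_sum ?M) (strict_decreasing n)"
    using has_sum_Cauchy_Binet[of n "\<lambda>i k. c k * x i ^ k" "\<lambda>i k. a i ^ k", OF summable]
    by (simp add: D_def)
  then have "((\<lambda>m. (\<Prod>j<n. c (m j)) * D x m * D a m) has_sum ?M) (strict_decreasing n)"
    by (simp add: D_def det_mult_columns)
  then have "((\<lambda>p. (\<Prod>j<n. c (?m p j)) * D x (?m p) * D a (?m p)) has_sum ?M) (partitions n)"
    by (subst has_sum_reindex_bij_betw[OF bij_betw_partitions])
  \<comment> \<open>One constant factor supplies the denominators of both Schur polynomials in every
    term.\<close>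
  then have "((\<lambda>p. (\<Prod>j<n. c (?m p j)) * D x (?m p) * D a (?m p)
        * (1 / (vandermonde n x * vandermonde n a)))
      has_sum ?M * (1 / (vandermonde n x * vandermonde n a))) (partitions n)"
    by (rule has_sum_cmult_left)
  moreover have "(\<Prod>j<n. c (?m p j)) = G_coeff n g p / C_coeff n p" for p
    by (simp add: c_def maclaurin_coeff_def G_coeff_def C_coeff_def prod_dividef)
  moreover have "schur n p y = D y (?m p) / vandermonde n y" for p y
    unfolding schur_def D_def
    by (intro arg_cong2[where f = "(/)"] arg_cong[where f = Determinant.det] eq_matI) auto
  ultimately show ?thesis
    by (simp add: mult_ac)
qed

end
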